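(* Let $\mathbb D=\{(x,y)\in\mathbb R^2:x^2+y^2\le1\}$ with the Euclidean metric and $\Delta$ the Euclidean Laplacian. For $r\in(0,1]$ let $d_A(r)=-(\tanh(\alpha(r))-\alpha(r))$ with $\alpha(r)=\cosh^{-1}(1/r)$. Then for all $k\in\mathbb N$ there exist $\psi_k\in C^\infty(\mathbb D)\cap H^1_0(\mathbb D)$ and $\lambda_k\ge0$ with $$\lambda_k=k^2+O(k^{4/3}),\qquad\|\psi_k\|_{L^2(\mathbb D)}=1,\qquad-\Delta\psi_k=\lambda_k\psi_k,$$ and there exist $C,\beta,k_0>0$ such that for all $k\ge k_0$ and $0<r\le1-\beta\lambda_k^{-1/3}$, $$\|\psi_k\|_{L^\infty(B(0,r))}\le\exp\left(-(\sqrt{\lambda_k}-C\lambda_k^{1/6})d_A(r)+C\lambda_k^{1/6}\right).$$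
   Context: $B(0,r)$ is the Euclidean disk of radius $r$ centered at the origin. *)

theory Defs
  imports "HOL-Analysis.Analysis" "HOL-Library.Landau_Symbols"
begin

fun Ck_on :: "nat \<Rightarrow> ('a::euclidean_space \<Rightarrow> real) \<Rightarrow> 'a set \<Rightarrow> bool" where
  "Ck_on 0 f U = continuous_on U f"
| "Ck_on (Suc n) f U =
     ((\<forall>x\<in>U. f differentiable (at x)) \<and>
      (\<forall>v. Ck_on n (\<lambda>x. frechet_derivative f (at x) v) U))"

definition smooth_on :: "('a::euclidean_space \<Rightarrow> real) \<Rightarrow> 'a set \<Rightarrow> bool" where
  "smooth_on f U \<longleftrightarrow> open U \<and> (\<forall>n. Ck_on n f U)"

definition smooth_closed_disk :: "(real^2 \<Rightarrow> real) \<Rightarrow> bool" where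
  "smooth_closed_disk f \<longleftrightarrow> (\<exists>U. cball 0 1 \<subseteq> U \<and> smooth_on f U)"

definition laplacian :: "('a::euclidean_space \<Rightarrow> real) \<Rightarrow> 'a \<Rightarrow> real" where
  "laplacian f x = (\<Sum>i\<in>Basis.
      frechet_derivative (\<lambda>y. frechet_derivative f (at y) i) (at x) i)"

definition dA :: "real \<Rightarrow> real" where
  "dA r = - (tanh (arcosh (1 / r)) - arcosh (1 / r))"

end

theory Submission
  imports Defs
begin

text \<open>
  The eigenfunctions are the whispering gallery modes Re(z^k) B_k(l^2 |z|^2), normalised in L2, where
  J(x) = x^k B_k(x^2) is a multiple of the Bessel function of order k and l > k is a zero of J.
  With D = x d/dx, Bessel's equation is D D J = (k^2 - x^2) J, an oscillator in the variable ln x.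

  Sturm comparison with sin(w ln x), w = k^(2/3), gives a zero l with l^2 - k^2 = O(k^(4/3)).
  The energy (D J)^2 - (k^2 - x^2) J^2 has derivative 2 x J^2 and vanishes at 0, hence
  D J >= sqrt(k^2 - x^2) J up to x = k. Since the function dA has derivative - sqrt(1 - r^2) / r, integrating this
  bound gives the decay rate l dA(r), up to the error (l^2 - k^2) / l * arcosh(1/r), which is O(l^(1/3) (dA(r) + 1)).
  Finally the L2 norm is bounded below, up to a power of l, by the value of J at the endpoint of the range
  of r, because J is increasing up to the turning point and the mode is comparable to J on a box of side
  about 1/l behind that endpoint.
\<close>

section \<open>Bessel functions of integer order\<close>

text \<open>With this normalisation \<open>bessel_series j (x\<^sup>2)\<close> is (2/x)^j J_j(x) for
  the classical Bessel function J_j. It is an entire function of s = x^2 that does not vanish at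
  0.\<close>

definition bessel_coeff :: "nat \<Rightarrow> nat \<Rightarrow> real" where
  "bessel_coeff j m = (-1/4) ^ m / (fact m * fact (m + j))"

definition bessel_series :: "nat \<Rightarrow> real \<Rightarrow> real" where
  "bessel_series j s = (\<Sum>m. bessel_coeff j m * s ^ m)"

lemma summable_bessel_coeff: "summable (\<lambda>m. bessel_coeff j m * s ^ m)"
proof (rule summable_comparison_test)
  show "summable (\<lambda>m. inverse (fact m) * \<bar>s / 4\<bar> ^ m)"
    by (rule summable_exp)
  have "norm (bessel_coeff j m * s ^ m) \<le> inverse (fact m) * \<bar>s / 4\<bar> ^ m" for m
  proof -
    have "norm (bessel_coeff j m * s ^ m) = inverse (fact m) * \<bar>s / 4\<bar> ^ m * inverse (fact (m + j))"
      by (simp add: bessel_coeff_def abs_mult power_abs power_divide field_simps)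
    also have "\<dots> \<le> inverse (fact m) * \<bar>s / 4\<bar> ^ m * 1"
      by (intro mult_left_mono) (simp_all add: inverse_le_1_iff fact_ge_1)
    finally show ?thesis by simp
  qed
  then show "\<exists>N. \<forall>m\<ge>N. norm (bessel_coeff j m * s ^ m) \<le> inverse (fact m) * \<bar>s / 4\<bar> ^ m"
    by blast
qed

text \<open>Differentiating termwise cancels m + 1 against (m + 1)!, and (m + 1 + j)! is the
  factorial belonging to order j + 1. Differentiation thus only raises the order, so all derivatives
  stay in one family.\<close>

lemma bessel_series_has_derivative:
  "(bessel_series j has_field_derivative - (1/4) * bessel_series (Suc j) s) (at s)"
proof -
  have "diffs (bessel_coeff j) m = - (1/4) * bessel_coeff (Suc j) m" for m
  proof -
    have "real (Suc m) * (q / (real (Suc m) * f * g)) = q / (f * g)" for q f g :: real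
      by simp
    then show ?thesis
      unfolding diffs_def bessel_coeff_def by (simp add: fact_Suc[of m] del: of_nat_Suc)
  qed
  then have "(\<Sum>m. diffs (bessel_coeff j) m * s ^ m) = - (1/4) * bessel_series (Suc j) s"
    unfolding bessel_series_def
    by (simp add: suminf_mult[OF summable_bessel_coeff, symmetric] suminf_minus[symmetric] mult.assoc
       del: suminf_mult2 suminf_mult)
  then show ?thesis
    using termdiffs_strong_converges_everywhere[OF summable_bessel_coeff[of j], of s]
    unfolding bessel_series_def[abs_def] by simp
qed

lemmas bessel_series_DERIV [derivative_intros] =
  bessel_series_has_derivative[THEN DERIV_chain2]

lemma isCont_bessel_series: "isCont (bessel_series j) s"
  using bessel_series_has_derivative DERIV_isCont by blast

lemma continuous_on_bessel_series [continuous_intros]: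
  "continuous_on S f \<Longrightarrow> continuous_on S (\<lambda>x. bessel_series j (f x))"
  by (rule continuous_on_compose2[of UNIV "bessel_series j" S f])
     (auto intro!: continuous_at_imp_continuous_on isCont_bessel_series)

lemma bessel_series_0: "bessel_series j 0 > 0"
proof -
  have "bessel_series j 0 = bessel_coeff j 0"
    unfolding bessel_series_def by (rule powser_zero)
  then show ?thesis
    by (simp add: bessel_coeff_def)
qed

text \<open>This is J_k + J_(k+2) = (2 (k + 1) / x) J_(k+1) after rescaling. Given the derivative
  rule, it is Bessel's equation without derivatives. Coefficientwise it reduces to (k + 1) + m = m +
  k + 1.\<close>

lemma bessel_series_recurrence:
  "bessel_series k s = (real k + 1) * bessel_series (Suc k) s - s / 4 * bessel_series (Suc (Suc k)) s"
proof -
  have sums: "(\<lambda>m. bessel_coeff j m * s ^ m) sums bessel_series j s" for j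
    unfolding bessel_series_def using summable_bessel_coeff by (rule summable_sums)
  \<comment> \<open>The factor s shifts the series of order k + 2 by one place; the entry 0 at index
    0 aligns it with the other two series.\<close>
  define g where "g m = (case m of 0 \<Rightarrow> 0 | Suc n \<Rightarrow> s / 4 * (bessel_coeff (Suc (Suc k)) n * s ^ n))" for m
  have "(\<lambda>n. g (Suc n)) sums (s / 4 * bessel_series (Suc (Suc k)) s)"
    unfolding g_def by (simp only: nat.case) (intro sums_mult sums)
  then have "g sums (s / 4 * bessel_series (Suc (Suc k)) s)"
    by (subst (asm) sums_Suc_iff) (simp add: g_def)
  then have "(\<lambda>m. (real k + 1) * (bessel_coeff (Suc k) m * s ^ m) - g m) sums
      ((real k + 1) * bessel_series (Suc k) s - s / 4 * bessel_series (Suc (Suc k)) s)"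
    by (intro sums_diff sums_mult sums)
  moreover have "(real k + 1) * (bessel_coeff (Suc k) m * s ^ m) - g m = bessel_coeff k m * s ^ m" for m
  proof (cases m)
    case 0
    have "(real k + 1) / ((real k + 1) * f) = 1 / f" for f :: real
      by (simp add: add_nonneg_eq_0_iff)
    then show ?thesis
      using 0 by (simp add: g_def bessel_coeff_def add.commute)
  next
    case (Suc n)
    have f1: "fact (Suc n + Suc k) = (real n + real k + 2) * (fact (Suc n + k) :: real)"
      by (simp add: algebra_simps)
    have f2: "fact (n + Suc (Suc k)) = (real n + real k + 2) * (fact (Suc n + k) :: real)"
      by (simp add: algebra_simps)
    have f3: "fact (Suc n) = (real n + 1) * (fact n :: real)"
      by simp
    have key: "(real k + 1) * ((- 1 / 4) ^ Suc n / (a * f * (b * F)) * s ^ Suc n)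
        - s / 4 * ((- 1 / 4) ^ n / (f * (b * F)) * s ^ n) = (- 1 / 4) ^ Suc n / (a * f * F) * s ^ Suc n"
      if "a > 0" "f > 0" "b > 0" "F > 0" "b = real k + 1 + a" for a b f F :: real
      using that(1-4) by (simp add: divide_simps) (simp add: that(5) algebra_simps)
    show ?thesis
      unfolding Suc g_def bessel_coeff_def nat.case f1 f2 f3 by (rule key) auto
  qed
  ultimately show ?thesis
    using sums sums_unique2 by (metis (no_types, lifting) sums_cong)
qed

text \<open>This is 2^k times the classical J_k, and the derivative below is taken with respect to ln x.\<close>

definition bessel :: "nat \<Rightarrow> real \<Rightarrow> real" where
  "bessel k x = x ^ k * bessel_series k (x\<^sup>2)"

definition bessel_log_deriv :: "nat \<Rightarrow> real \<Rightarrow> real" where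
  "bessel_log_deriv k x = real k * bessel k x - x ^ (k + 2) / 2 * bessel_series (Suc k) (x\<^sup>2)"

section \<open>Bessel's equation as a first-order system in ln x\<close>

lemma bessel_DERIV:
  assumes "x > 0"
  shows "(bessel k has_field_derivative bessel_log_deriv k x / x) (at x)"
proof -
  have "real k * x ^ (k - 1) = real k * x ^ k / x"
    using assms by (cases k) auto
  then show ?thesis
    unfolding bessel_def[abs_def] bessel_log_deriv_def
    using assms by (auto intro!: derivative_eq_intros simp: field_simps power2_eq_square)
qed

lemma bessel_log_deriv_DERIV:
  assumes "x > 0"
  shows "(bessel_log_deriv k has_field_derivative ((real k)\<^sup>2 - x\<^sup>2) * bessel k x / x) (at x)"
proof -
  have p: "((\<lambda>x. x ^ (k + 2)) has_field_derivative real (k + 2) * x ^ (k + 1)) (at x)"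
    using DERIV_pow[of "k + 2" x UNIV] by simp
  have q: "((\<lambda>x. bessel_series (Suc k) (x\<^sup>2)) has_field_derivative
      - (1/4) * bessel_series (Suc (Suc k)) (x\<^sup>2) * (2 * x)) (at x)"
    by (auto intro!: derivative_eq_intros)
  have "(bessel_log_deriv k has_field_derivative
      real k * (bessel_log_deriv k x / x) -
      (real (k + 2) * x ^ (k + 1) / 2 * bessel_series (Suc k) (x\<^sup>2) +
       x ^ (k + 2) / 2 * (- (1/4) * bessel_series (Suc (Suc k)) (x\<^sup>2) * (2 * x)))) (at x)"
    unfolding bessel_log_deriv_def[abs_def]
    by (rule DERIV_cong[OF DERIV_diff[OF DERIV_cmult[OF bessel_DERIV[OF assms]]
          DERIV_mult[OF DERIV_cdivide[OF p] q]]]) (simp add: bessel_log_deriv_def algebra_simps)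
  moreover have "real k * (bessel_log_deriv k x / x) -
      (real (k + 2) * x ^ (k + 1) / 2 * bessel_series (Suc k) (x\<^sup>2) +
       x ^ (k + 2) / 2 * (- (1/4) * bessel_series (Suc (Suc k)) (x\<^sup>2) * (2 * x)))
     = ((real k)\<^sup>2 - x\<^sup>2) * bessel k x / x"
    using assms unfolding bessel_log_deriv_def bessel_def bessel_series_recurrence[of k]
    by (simp add: field_simps power2_eq_square)
  ultimately show ?thesis by simp
qed

lemmas bessel_DERIV_chain [derivative_intros] =
  bessel_DERIV[THEN DERIV_chain2] bessel_log_deriv_DERIV[THEN DERIV_chain2]

lemma continuous_on_bessel [continuous_intros]:
  "continuous_on S f \<Longrightarrow> continuous_on S (\<lambda>x. bessel k (f x))"
  unfolding bessel_def by (intro continuous_intros)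

lemma continuous_on_bessel_log_deriv [continuous_intros]:
  "continuous_on S f \<Longrightarrow> continuous_on S (\<lambda>x. bessel_log_deriv k (f x))"
  unfolding bessel_log_deriv_def by (intro continuous_intros) auto

section \<open>Positivity and growth up to the turning point x = k\<close>

text \<open>With D = x d/dx, D (J * D J) = (D J)^2 + (k^2 - x^2) J^2, which is nonnegative up to x =
  k, and the product vanishes at 0.\<close>

lemma bessel_times_log_deriv_nonneg:
  assumes "k > 0" "0 \<le> x" "x \<le> real k"
  shows "0 \<le> bessel k x * bessel_log_deriv k x"
proof -
  have "bessel k 0 * bessel_log_deriv k 0 \<le> bessel k x * bessel_log_deriv k x"
  proof (rule DERIV_nonneg_imp_increasing_open[OF assms(2)])
    fix y assume y: "0 < y" "y < x"
    have "y\<^sup>2 \<le> (real k)\<^sup>2"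
      using y assms by (intro power_mono) auto
    then have "0 \<le> ((bessel_log_deriv k y)\<^sup>2 + ((real k)\<^sup>2 - y\<^sup>2) * (bessel k y)\<^sup>2) / y"
      using y by simp
    moreover have "((\<lambda>x. bessel k x * bessel_log_deriv k x) has_field_derivative
        ((bessel_log_deriv k y)\<^sup>2 + ((real k)\<^sup>2 - y\<^sup>2) * (bessel k y)\<^sup>2) / y) (at y)"
      using y by (auto intro!: derivative_eq_intros simp: field_simps power2_eq_square)
    ultimately show "\<exists>D. ((\<lambda>x. bessel k x * bessel_log_deriv k x) has_field_derivative D) (at y) \<and> 0 \<le> D"
      by blast
  qed (intro continuous_intros)
  moreover have "bessel k 0 = 0"
    using assms(1) by (simp add: bessel_def)
  ultimately show ?thesis by simp
qed

text \<open>Follows from D (J^2) = 2 J * D J. The square is used because the sign of J is settled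
  only afterwards, by means of this lemma.\<close>

lemma bessel_square_mono:
  assumes "k > 0" "0 \<le> x" "x \<le> y" "y \<le> real k"
  shows "(bessel k x)\<^sup>2 \<le> (bessel k y)\<^sup>2"
proof (rule DERIV_nonneg_imp_increasing_open[OF assms(3)])
  fix t assume t: "x < t" "t < y"
  have "0 \<le> bessel k t * bessel_log_deriv k t"
    using t assms by (intro bessel_times_log_deriv_nonneg) auto
  then have "0 \<le> 2 * (bessel k t * bessel_log_deriv k t) / t"
    using t assms by auto
  moreover have "((\<lambda>x. (bessel k x)\<^sup>2) has_field_derivative
      2 * (bessel k t * bessel_log_deriv k t) / t) (at t)"
    using t assms by (auto intro!: derivative_eq_intros)
  ultimately show "\<exists>D. ((\<lambda>x. (bessel k x)\<^sup>2) has_field_derivative D) (at t) \<and> 0 \<le> D"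
    by blast
qed (intro continuous_intros)

text \<open>For x > 0, J and its series factor have the same sign, and that factor is positive at 0,
  so the intermediate value theorem applies to it. It cannot be applied to J itself, which vanishes
  at 0 when k > 0.\<close>

lemma bessel_pos_if_no_zero:
  assumes "\<And>y. 0 < y \<Longrightarrow> y \<le> x \<Longrightarrow> bessel k y \<noteq> 0" and "0 < x"
  shows "bessel k x > 0"
proof (rule ccontr)
  assume neg: "\<not> bessel k x > 0"
  have "bessel_series k (x\<^sup>2) \<le> 0"
    using neg assms(2) by (simp add: bessel_def zero_less_mult_iff not_less)
  moreover have "continuous_on {0..x} (\<lambda>x. bessel_series k (x\<^sup>2))"
    by (intro continuous_intros)
  ultimately obtain y where y: "0 \<le> y" "y \<le> x" "bessel_series k (y\<^sup>2) = 0"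
    using IVT2'[of "\<lambda>x. bessel_series k (x\<^sup>2)" x 0 0] bessel_series_0[of k] assms(2) by auto
  then have "y \<noteq> 0"
    using bessel_series_0[of k] by auto
  then show False
    using assms(1)[of y] y by (auto simp: bessel_def)
qed

text \<open>At a zero y the increasing function J^2 would vanish on all of (0, y). The series factor
  would then be 0 near 0, against its positive value at 0.\<close>

lemma bessel_pos:
  assumes "k > 0" "0 < x" "x \<le> real k"
  shows "bessel k x > 0"
proof (rule bessel_pos_if_no_zero[OF _ assms(2)])
  fix y assume y: "0 < y" "y \<le> x"
  show "bessel k y \<noteq> 0"
  proof
    assume zero: "bessel k y = 0"
    have vanish: "bessel_series k (t\<^sup>2) = 0" if "0 < t" "t < y" for t
    proof -
      have "(bessel k t)\<^sup>2 \<le> (bessel k y)\<^sup>2"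
        using that y assms by (intro bessel_square_mono) auto
      then show ?thesis
        using zero that by (simp add: bessel_def)
    qed
    have "isCont (\<lambda>t. bessel_series k (t\<^sup>2)) 0"
      by (rule continuous_on_interior[of UNIV]) (auto intro!: continuous_intros)
    then have "((\<lambda>t. bessel_series k (t\<^sup>2)) \<longlongrightarrow> bessel_series k 0) (at_right 0)"
      by (auto simp: isCont_def dest: tendsto_within_subset)
    moreover have "((\<lambda>t. bessel_series k (t\<^sup>2)) \<longlongrightarrow> 0) (at_right 0)"
    proof (rule tendsto_eventually)
      show "\<forall>\<^sub>F t in at_right 0. bessel_series k (t\<^sup>2) = 0"
        unfolding eventually_at_right_field using vanish y by blast
    qed
    ultimately have "bessel_series k 0 = 0"
      by (intro tendsto_unique[of "at_right (0::real)"]) auto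
    then show False
      using bessel_series_0[of k] by simp
  qed
qed

lemma bessel_mono:
  assumes "k > 0" "0 \<le> x" "x \<le> y" "y \<le> real k"
  shows "bessel k x \<le> bessel k y"
proof -
  have "0 \<le> bessel k y"
    using bessel_pos[of k y] assms by (cases "y = 0") (auto simp: bessel_def zero_power)
  then show ?thesis
    using bessel_square_mono[OF assms] by (rule power2_le_imp_le[rotated])
qed

lemma bessel_log_deriv_ge:
  assumes "k > 0" "0 < x" "x \<le> real k"
  shows "bessel_log_deriv k x \<ge> sqrt ((real k)\<^sup>2 - x\<^sup>2) * bessel k x"
proof -
  define E where "E x = (bessel_log_deriv k x)\<^sup>2 - ((real k)\<^sup>2 - x\<^sup>2) * (bessel k x)\<^sup>2" for x
  have "E 0 \<le> E x"
  proof (rule DERIV_nonneg_imp_increasing_open[of 0 x E])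
    fix y assume y: "0 < y" "y < x"
    have "(E has_field_derivative 2 * y * (bessel k y)\<^sup>2) (at y)"
      unfolding E_def using y by (auto intro!: derivative_eq_intros simp: field_simps power2_eq_square)
    moreover have "0 \<le> 2 * y * (bessel k y)\<^sup>2"
      using y by simp
    ultimately show "\<exists>D. (E has_field_derivative D) (at y) \<and> 0 \<le> D"
      by blast
  next
    show "continuous_on {0..x} E"
      unfolding E_def by (intro continuous_intros)
  qed (use assms in simp)
  moreover have "E 0 = 0"
    using assms(1) by (simp add: E_def bessel_log_deriv_def bessel_def zero_power)
  ultimately have "((real k)\<^sup>2 - x\<^sup>2) * (bessel k x)\<^sup>2 \<le> (bessel_log_deriv k x)\<^sup>2"
    by (simp add: E_def)
  moreover have "x\<^sup>2 \<le> (real k)\<^sup>2"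
    using assms by (intro power_mono) auto
  ultimately have "(sqrt ((real k)\<^sup>2 - x\<^sup>2) * bessel k x)\<^sup>2 \<le> (bessel_log_deriv k x)\<^sup>2"
    by (simp add: power_mult_distrib)
  \<comment> \<open>The energy only compares squares; the sign of D J is needed to take
    roots.\<close>
  moreover have "0 \<le> bessel_log_deriv k x"
    using bessel_times_log_deriv_nonneg[of k x] bessel_pos[OF assms] assms
    by (simp add: zero_le_mult_iff)
  ultimately show ?thesis
    by (rule power2_le_imp_le)
qed

section \<open>A zero beyond the turning point by Sturm comparison\<close>

text \<open>For x at least a = sqrt(k^2 + \<omega>^2) the oscillator D D J = -(x^2 - k^2) J has
  squared frequency at least \<omega>^2. It is compared with sin(\<omega> ln(x/a)) over one half
  period, of length pi/\<omega> in ln x. If J stayed positive, the Wronskian \<open>W\<close> would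
  decrease from a to b, although W a < 0 < W b.\<close>

lemma bessel_zero_exists:
  fixes \<omega> :: real
  assumes "k > 0" "\<omega> > 0"
  shows "\<exists>x. real k < x \<and> x \<le> sqrt ((real k)\<^sup>2 + \<omega>\<^sup>2) * exp (pi / \<omega>) \<and> bessel k x = 0"
proof (rule ccontr)
  assume no_zero: "\<not> ?thesis"
  define a where "a = sqrt ((real k)\<^sup>2 + \<omega>\<^sup>2)"
  define b where "b = a * exp (pi / \<omega>)"
  have a: "a > 0" "a\<^sup>2 = (real k)\<^sup>2 + \<omega>\<^sup>2"
    using assms by (auto simp: a_def intro!: real_sqrt_gt_zero add_pos_pos)
  have ab: "a \<le> b"
    using a assms by (simp add: b_def)
  have pos: "bessel k x > 0" if "0 < x" "x \<le> b" for x
  proof (rule bessel_pos_if_no_zero[OF _ that(1)])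
    fix y assume "0 < y" "y \<le> x"
    then show "bessel k y \<noteq> 0"
      using bessel_pos[OF assms(1), of y] no_zero that
      by (cases "y \<le> real k") (auto simp: a_def b_def)
  qed
  define W where "W x = bessel_log_deriv k x * sin (\<omega> * ln (x / a)) - \<omega> * bessel k x * cos (\<omega> * ln (x / a))" for x
  have "W b \<le> W a"
  proof (rule DERIV_nonpos_imp_nonincreasing[OF ab])
    fix x assume x: "a \<le> x" "x \<le> b"
    have x0: "0 < x"
      using x a by linarith
    have "ln (x / a) \<le> ln (exp (pi / \<omega>))"
      using x a x0 by (subst ln_le_cancel_iff) (auto simp: b_def field_simps)
    then have "\<omega> * ln (x / a) \<le> pi"
      using assms by (simp add: field_simps)
    moreover have "0 \<le> \<omega> * ln (x / a)"
      using x a assms by (simp add: field_simps)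
    ultimately have sin: "0 \<le> sin (\<omega> * ln (x / a))"
      by (rule sin_ge_zero[rotated])
    have "a\<^sup>2 \<le> x\<^sup>2"
      using x a by (intro power_mono) auto
    then have le: "(real k)\<^sup>2 + \<omega>\<^sup>2 - x\<^sup>2 \<le> 0"
      using a by simp
    have L: "((\<lambda>x. \<omega> * ln (x / a)) has_field_derivative \<omega> / x) (at x)"
      using x0 a by (auto intro!: derivative_eq_intros)
    have "(W has_field_derivative
        ((real k)\<^sup>2 + \<omega>\<^sup>2 - x\<^sup>2) * (bessel k x * sin (\<omega> * ln (x / a)) / x)) (at x)"
      unfolding W_def
      by (rule DERIV_cong[OF DERIV_diff[OF
            DERIV_mult[OF bessel_log_deriv_DERIV[OF x0] DERIV_fun_sin[OF L]]
            DERIV_mult[OF DERIV_cmult[OF bessel_DERIV[OF x0]] DERIV_fun_cos[OF L]]]])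
         (use x0 in \<open>simp add: field_simps power2_eq_square\<close>)
    moreover have "((real k)\<^sup>2 + \<omega>\<^sup>2 - x\<^sup>2) * (bessel k x * sin (\<omega> * ln (x / a)) / x) \<le> 0"
      using le sin pos[OF x0 x(2)] x0 by (intro mult_nonpos_nonneg) auto
    ultimately show "\<exists>D. (W has_field_derivative D) (at x) \<and> D \<le> 0"
      by blast
  qed
  moreover have "W a = - \<omega> * bessel k a"
    using a by (simp add: W_def)
  moreover have "W b = \<omega> * bessel k b"
    using a assms by (simp add: W_def b_def)
  moreover have "0 < \<omega> * bessel k a" "0 < \<omega> * bessel k b"
    using pos[of a] pos[of b] a ab assms by auto
  ultimately show False by linarith
qed

section \<open>Separated solutions on the plane\<close>

lemma smooth_on_UNIV_if_closed:
  assumes "\<And>f. f \<in> S \<Longrightarrow> (\<forall>x. f differentiable (at x)) \<and> (\<forall>v. (\<lambda>x. frechet_derivative f (at x) v) \<in> S)"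
    and "f \<in> S"
  shows "smooth_on f UNIV"
proof -
  have "Ck_on n f UNIV" for n
    using assms(2)
  proof (induction n arbitrary: f)
    case 0
    then show ?case
      using assms(1) by (auto intro!: continuous_at_imp_continuous_on differentiable_imp_continuous_within)
  next
    case (Suc n)
    then show ?case
      using assms(1) by auto
  qed
  then show ?thesis
    by (simp add: smooth_on_def)
qed

text \<open>An algebra of functions built to be closed under directional derivatives. All orders j
  occur because differentiating the radial factor of order j produces that of order j + 1 times a
  linear polynomial.\<close>

inductive_set bessel_algebra :: "real \<Rightarrow> (real^2 \<Rightarrow> real) set" for \<mu> :: real where
  const: "(\<lambda>_. c) \<in> bessel_algebra \<mu>"
| coord: "(\<lambda>x. x $ i) \<in> bessel_algebra \<mu>"
| bessel: "(\<lambda>x. bessel_series j (\<mu> * (x \<bullet> x))) \<in> bessel_algebra \<mu>"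
| add: "f \<in> bessel_algebra \<mu> \<Longrightarrow> g \<in> bessel_algebra \<mu> \<Longrightarrow> (\<lambda>x. f x + g x) \<in> bessel_algebra \<mu>"
| mult: "f \<in> bessel_algebra \<mu> \<Longrightarrow> g \<in> bessel_algebra \<mu> \<Longrightarrow> (\<lambda>x. f x * g x) \<in> bessel_algebra \<mu>"

lemma bessel_algebra_diff:
  assumes "f \<in> bessel_algebra \<mu>" "g \<in> bessel_algebra \<mu>"
  shows "(\<lambda>x. f x - g x) \<in> bessel_algebra \<mu>"
proof -
  have "(\<lambda>x. f x + (- 1) * g x) \<in> bessel_algebra \<mu>"
    by (intro bessel_algebra.add bessel_algebra.mult bessel_algebra.const assms)
  then show ?thesis by simp
qed

lemma bessel_series_radial_has_derivative:
  fixes x :: "'a::real_inner"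
  shows "((\<lambda>x. bessel_series j (\<mu> * (x \<bullet> x))) has_derivative
     (\<lambda>h. - (\<mu> / 2) * bessel_series (Suc j) (\<mu> * (x \<bullet> x)) * (x \<bullet> h))) (at x)"
proof -
  have "((\<lambda>x. \<mu> * (x \<bullet> x)) has_derivative (\<lambda>h. \<mu> * (2 * (x \<bullet> h)))) (at x)"
    by (auto intro!: derivative_eq_intros simp: inner_commute)
  from has_derivative_compose[OF this
      bessel_series_has_derivative[unfolded has_field_derivative_def, of j "\<mu> * (x \<bullet> x)"]]
  show ?thesis
    by (rule has_derivative_eq_rhs) (simp add: fun_eq_iff)
qed

lemma bessel_algebra_has_derivative:
  assumes "f \<in> bessel_algebra \<mu>"
  shows "\<exists>D. (\<forall>x. (f has_derivative D x) (at x)) \<and> (\<forall>v. (\<lambda>x. D x v) \<in> bessel_algebra \<mu>)"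
  using assms
proof induction
  case (const c)
  show ?case
    by (rule exI[of _ "\<lambda>_ _. 0"]) (auto intro: bessel_algebra.const)
next
  case (coord i)
  show ?case
    by (rule exI[of _ "\<lambda>_ h. h $ i"])
       (auto intro: bessel_algebra.const bounded_linear_imp_has_derivative)
next
  case (bessel j)
  have "(\<lambda>x. - (\<mu> / 2) * bessel_series (Suc j) (\<mu> * (x \<bullet> x)) * (x \<bullet> v)) \<in> bessel_algebra \<mu>" for v
    unfolding inner_vec_def[of _ v] sum_2 inner_real_def
    by (intro bessel_algebra.intros)
  then show ?case
    using bessel_series_radial_has_derivative by (intro exI conjI allI) auto
next
  case (add f g)
  then obtain D E where "\<forall>x. (f has_derivative D x) (at x)" "\<forall>v. (\<lambda>x. D x v) \<in> bessel_algebra \<mu>"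
    "\<forall>x. (g has_derivative E x) (at x)" "\<forall>v. (\<lambda>x. E x v) \<in> bessel_algebra \<mu>"
    by blast
  then show ?case
    by (intro exI[of _ "\<lambda>x h. D x h + E x h"]) (auto intro!: bessel_algebra.add has_derivative_add)
next
  case (mult f g)
  then obtain D E where "\<forall>x. (f has_derivative D x) (at x)" "\<forall>v. (\<lambda>x. D x v) \<in> bessel_algebra \<mu>"
    "\<forall>x. (g has_derivative E x) (at x)" "\<forall>v. (\<lambda>x. E x v) \<in> bessel_algebra \<mu>"
    by blast
  then show ?case
    using mult
    by (intro exI[of _ "\<lambda>x h. f x * E x h + D x h * g x"])
       (auto intro!: bessel_algebra.add bessel_algebra.mult has_derivative_mult)
qed

lemma smooth_on_bessel_algebra:
  assumes "f \<in> bessel_algebra \<mu>"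
  shows "smooth_on f UNIV"
  using _ assms
proof (rule smooth_on_UNIV_if_closed)
  fix f assume "f \<in> bessel_algebra \<mu>"
  then obtain D where D: "\<And>x. (f has_derivative D x) (at x)" "\<And>v. (\<lambda>x. D x v) \<in> bessel_algebra \<mu>"
    using bessel_algebra_has_derivative by blast
  have "frechet_derivative f (at x) = D x" for x
    using frechet_derivative_at[OF D(1)] by simp
  then show "(\<forall>x. f differentiable (at x)) \<and> (\<forall>v. (\<lambda>x. frechet_derivative f (at x) v) \<in> bessel_algebra \<mu>)"
    using D by (auto intro: differentiableI)
qed

section \<open>The modes and their eigenvalue equation\<close>

definition plane_complex :: "real^2 \<Rightarrow> complex" where
  "plane_complex x = Complex (x $ 1) (x $ 2)"

lemma bounded_linear_plane_complex: "bounded_linear plane_complex"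
  by (rule linear_conv_bounded_linear[THEN iffD1], rule linearI)
     (auto simp: plane_complex_def complex_eq_iff)

lemmas plane_complex_has_derivative [derivative_intros] =
  bounded_linear.has_derivative[OF bounded_linear_plane_complex]

lemma norm_plane_complex: "norm (plane_complex x) = norm x"
  by (simp add: plane_complex_def complex_norm norm_vec_def L2_set_def sum_2)

text \<open>In polar coordinates, for \<mu> > 0, this is a multiple of cos(k \<theta>)
  J_k(sqrt(\<mu>) r). The Cartesian form makes smoothness at the origin visible.\<close>

definition disk_mode :: "nat \<Rightarrow> real \<Rightarrow> real^2 \<Rightarrow> real" where
  "disk_mode k \<mu> x = Re (plane_complex x ^ k) * bessel_series k (\<mu> * (x \<bullet> x))"

lemma disk_mode_in_bessel_algebra: "disk_mode k \<mu> \<in> bessel_algebra \<mu>"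
proof -
  \<comment> \<open>Real and imaginary parts go through the induction together, since multiplication
    by z mixes them.\<close>
  have "(\<lambda>x. Re (plane_complex x ^ n)) \<in> bessel_algebra \<mu> \<and> (\<lambda>x. Im (plane_complex x ^ n)) \<in> bessel_algebra \<mu>" for n
  proof (induction n)
    case (Suc n)
    have "(\<lambda>x. x $ 1 * Re (plane_complex x ^ n) - x $ 2 * Im (plane_complex x ^ n)) \<in> bessel_algebra \<mu>"
      "(\<lambda>x. x $ 1 * Im (plane_complex x ^ n) + x $ 2 * Re (plane_complex x ^ n)) \<in> bessel_algebra \<mu>"
      using Suc
      by (auto intro!: bessel_algebra_diff bessel_algebra.add bessel_algebra.mult bessel_algebra.coord)
    then show ?case
      by (simp add: plane_complex_def)
  qed (auto intro: bessel_algebra.const)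
  then show ?thesis
    unfolding disk_mode_def[abs_def] by (intro bessel_algebra.mult bessel_algebra.bessel) auto
qed

text \<open>Write the mode as P B with P = Re z^k. P is harmonic, Euler's identity turns the mixed
  term 2 grad P . grad B into -\<mu> k P B_(k+1), and the recurrence collapses the rest. The
  constant c is carried so that normalised modes are covered directly.\<close>

lemma laplacian_cmult_disk_mode:
  "laplacian (\<lambda>x. c * disk_mode k \<mu> x) x = - \<mu> * (c * disk_mode k \<mu> x)"
proof -
  define B where "B j y = bessel_series (k + j) (\<mu> * (y \<bullet> y))" for j and y :: "real^2"
  have dB: "(B j has_derivative (\<lambda>h. - (\<mu> / 2) * B (Suc j) y * (y \<bullet> h))) (at y)" for j y
    unfolding B_def[abs_def] using bessel_series_radial_has_derivative[of "k + j" \<mu> y] by simp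
  \<comment> \<open>The factor w allows reuse: w = 1 for the first derivative, and w = k times the
    direction for the second. The truncated \<open>n - 1\<close> at n = 0 is harmless because the
    factor n vanishes there.\<close>
  have dP: "((\<lambda>y. Re (w * plane_complex y ^ n)) has_derivative
      (\<lambda>h. Re (w * (of_nat n * (plane_complex h * plane_complex y ^ (n - 1)))))) (at y)" for w n y
    by (rule has_derivative_eq_rhs, (rule derivative_intros)+) (simp add: fun_eq_iff algebra_simps)
  define g where "g i y = c * (Re (of_nat k * plane_complex i * plane_complex y ^ (k - 1)) * B 0 y
      - (\<mu> / 2) * (Re (plane_complex y ^ k) * B 1 y * (y \<bullet> i)))" for i y
  have fst: "((\<lambda>y. c * disk_mode k \<mu> y) has_derivative (\<lambda>i. g i y)) (at y)" for y
  proof -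
    have "((\<lambda>y. c * (Re (1 * plane_complex y ^ k) * B 0 y)) has_derivative
       (\<lambda>h. c * (Re (1 * plane_complex y ^ k) * (- (\<mu> / 2) * B (Suc 0) y * (y \<bullet> h)) +
         Re (1 * (of_nat k * (plane_complex h * plane_complex y ^ (k - 1)))) * B 0 y))) (at y)"
      by (intro has_derivative_mult_right has_derivative_mult dP dB)
    then show ?thesis
      unfolding disk_mode_def[abs_def] g_def
      by (auto simp: B_def algebra_simps elim!: has_derivative_eq_rhs)
  qed
  then have fd: "frechet_derivative (\<lambda>y. c * disk_mode k \<mu> y) (at y) i = g i y" for y i
    using frechet_derivative_at[OF fst] by metis
  define Z where "Z = plane_complex x"
  define h where "h i = c * (Re (of_nat k * plane_complex i * (of_nat (k - 1) * (plane_complex i * Z ^ (k - 1 - 1)))) * B 0 x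
      - \<mu> * (Re (of_nat k * (plane_complex i * Z ^ (k - 1))) * (B 1 x * (x \<bullet> i)))
      + (\<mu> / 2)\<^sup>2 * (Re (Z ^ k) * (B 2 x * (x \<bullet> i)\<^sup>2)) - (\<mu> / 2) * (Re (Z ^ k) * B 1 x * (i \<bullet> i)))" for i
  have snd: "frechet_derivative (\<lambda>y. g i y) (at x) i = h i" for i
  proof -
    have d0: "((\<lambda>y. y \<bullet> i) has_derivative (\<lambda>h. h \<bullet> i)) (at x)"
      by (auto intro!: derivative_eq_intros)
    have "((\<lambda>y. c * (Re (of_nat k * plane_complex i * plane_complex y ^ (k - 1)) * B 0 y
      - (\<mu> / 2) * (Re (1 * plane_complex y ^ k) * B 1 y * (y \<bullet> i)))) has_derivative
       (\<lambda>h. c * ((Re (of_nat k * plane_complex i * plane_complex x ^ (k - 1)) * (- (\<mu> / 2) * B (Suc 0) x * (x \<bullet> h)) +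
             Re (of_nat k * plane_complex i * (of_nat (k - 1) * (plane_complex h * plane_complex x ^ (k - 1 - 1)))) * B 0 x)
        - (\<mu> / 2) * ((Re (1 * plane_complex x ^ k) * B 1 x) * (h \<bullet> i) +
            (Re (1 * plane_complex x ^ k) * (- (\<mu> / 2) * B (Suc 1) x * (x \<bullet> h)) +
              Re (1 * (of_nat k * (plane_complex h * plane_complex x ^ (k - 1)))) * B 1 x) * (x \<bullet> i))))) (at x)"
      by (intro has_derivative_mult_right has_derivative_diff has_derivative_mult dP dB d0)
    from fun_cong[OF frechet_derivative_at[OF this], of i]
    have "frechet_derivative (\<lambda>y. g i y) (at x) i =
       c * ((Re (of_nat k * plane_complex i * Z ^ (k - 1)) * (- (\<mu> / 2) * B (Suc 0) x * (x \<bullet> i)) +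
             Re (of_nat k * plane_complex i * (of_nat (k - 1) * (plane_complex i * Z ^ (k - 1 - 1)))) * B 0 x)
        - (\<mu> / 2) * ((Re (Z ^ k) * B 1 x) * (i \<bullet> i) +
            (Re (Z ^ k) * (- (\<mu> / 2) * B (Suc 1) x * (x \<bullet> i)) +
              Re (of_nat k * (plane_complex i * Z ^ (k - 1))) * B 1 x) * (x \<bullet> i)))"
      unfolding g_def Z_def mult_1 by (rule sym)
    then show ?thesis
      unfolding h_def by (simp add: algebra_simps power2_eq_square numeral_2_eq_2)
  qed
  have "laplacian (\<lambda>x. c * disk_mode k \<mu> x) x = (\<Sum>i\<in>Basis. h i)"
    unfolding laplacian_def fd snd ..
  also have "\<dots> = h (axis 1 1) + h (axis 2 1)"
  proof -
    have Basis: "Basis = {axis 1 1, axis 2 (1::real) :: real^2}"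
      by (auto simp: Basis_vec_def UNIV_2)
    have "axis 1 1 \<noteq> (axis 2 1 :: real^2)"
      by (simp add: axis_eq_axis)
    then show ?thesis
      unfolding Basis by (subst sum.insert) auto
  qed
  also have "\<dots> = - \<mu> * (c * (Re (Z ^ k) * B 0 x))"
  proof -
    have Z: "Z = Complex (x $ 1) (x $ 2)"
      by (simp add: Z_def plane_complex_def)
    \<comment> \<open>The squares of these two values sum to 0, which cancels the second derivatives
      of Re z^k.\<close>
    have e: "plane_complex (axis 1 1) = 1" "plane_complex (axis 2 1) = \<i>"
      by (simp_all add: plane_complex_def axis_def complex_eq_iff)
    \<comment> \<open>Euler's identity for the homogeneous polynomial Re z^k.\<close>
    have rot: "real k * Re (Z ^ (k - 1)) * x $ 1 - real k * Im (Z ^ (k - 1)) * x $ 2 = real k * Re (Z ^ k)"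
      by (cases k) (simp_all add: Z algebra_simps)
    have xx: "x \<bullet> x = (x $ 1)\<^sup>2 + (x $ 2)\<^sup>2"
      by (simp add: inner_vec_def sum_2 power2_eq_square)
    have rec: "B 0 x = (real k + 1) * B 1 x - \<mu> * ((x $ 1)\<^sup>2 + (x $ 2)\<^sup>2) / 4 * B 2 x"
      using bessel_series_recurrence[of k "\<mu> * (x \<bullet> x)"] by (simp add: B_def xx)
    have "h (axis 1 1) + h (axis 2 1) = c * (- \<mu> * B 1 x * (real k * Re (Z ^ (k - 1)) * x $ 1 - real k * Im (Z ^ (k - 1)) * x $ 2)
       + (\<mu> / 2)\<^sup>2 * Re (Z ^ k) * B 2 x * ((x $ 1)\<^sup>2 + (x $ 2)\<^sup>2) - \<mu> * (Re (Z ^ k) * B 1 x))"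
      unfolding h_def e by (simp add: inner_axis algebra_simps)
    then show ?thesis
      unfolding rot rec by (simp add: field_simps power2_eq_square)
  qed
  finally show ?thesis
    by (simp add: disk_mode_def B_def Z_def)
qed

section \<open>Decay away from the boundary\<close>

lemma arcosh_inverse_DERIV:
  assumes "0 < r" "r < 1"
  shows "((\<lambda>r. arcosh (1 / r)) has_field_derivative - (1 / (r * sqrt (1 - r\<^sup>2)))) (at r)"
proof -
  have "(1 / r)\<^sup>2 - 1 = (1 - r\<^sup>2) / r\<^sup>2"
    using assms by (simp add: field_simps)
  then have eq: "sqrt ((1 / r)\<^sup>2 - 1) = sqrt (1 - r\<^sup>2) / r"
    using assms by (simp add: real_sqrt_divide)
  have "((\<lambda>r. 1 / r) has_field_derivative - (1 / r\<^sup>2)) (at r)"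
    using assms by (auto intro!: derivative_eq_intros simp: power2_eq_square)
  moreover have "1 / r > 1"
    using assms by simp
  ultimately have "((\<lambda>r. arcosh (1 / r)) has_field_derivative 1 / sqrt ((1 / r)\<^sup>2 - 1) * - (1 / r\<^sup>2)) (at r)"
    by (intro DERIV_chain2[OF arcosh_real_has_field_derivative])
  then show ?thesis
    unfolding eq by (rule DERIV_cong) (use assms in \<open>simp add: power2_eq_square\<close>)
qed

lemma dA_eq:
  assumes "0 < r" "r \<le> 1"
  shows "dA r = arcosh (1 / r) - sqrt (1 - r\<^sup>2)"
proof -
  have "(1 / r)\<^sup>2 - 1 = (1 - r\<^sup>2) / r\<^sup>2"
    using assms by (simp add: field_simps)
  then have "sqrt ((1 / r)\<^sup>2 - 1) = sqrt (1 - r\<^sup>2) / r"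
    using assms by (simp add: real_sqrt_divide)
  then have "tanh (arcosh (1 / r)) = sqrt (1 - r\<^sup>2)"
    using assms by (simp add: tanh_def sinh_arcosh_real)
  then show ?thesis
    by (simp add: dA_def)
qed

text \<open>Makes l * dA the WKB exponent: -t d/dt (l dA(t)) = sqrt(l^2 - (l t)^2), which is the
  lower bound for D J / J at l t in the ideal case k = l.\<close>

lemma dA_DERIV:
  assumes "0 < r" "r < 1"
  shows "(dA has_field_derivative - (sqrt (1 - r\<^sup>2) / r)) (at r)"
proof -
  have s: "1 - r\<^sup>2 > 0"
    using assms by (simp add: power_less_one_iff)
  have "((\<lambda>r. sqrt (1 - r\<^sup>2)) has_field_derivative - (r / sqrt (1 - r\<^sup>2))) (at r)"
    using s by (auto intro!: derivative_eq_intros simp: field_simps)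
  from DERIV_diff[OF arcosh_inverse_DERIV[OF assms] this]
  have "((\<lambda>r. arcosh (1 / r) - sqrt (1 - r\<^sup>2)) has_field_derivative - (sqrt (1 - r\<^sup>2) / r)) (at r)"
  proof (rule DERIV_cong)
    define q where "q = sqrt (1 - r\<^sup>2)"
    have q: "q > 0" "q * q = 1 - r * r"
      using s by (auto simp: q_def power2_eq_square)
    show "- (1 / (r * sqrt (1 - r\<^sup>2))) - - (r / sqrt (1 - r\<^sup>2)) = - (sqrt (1 - r\<^sup>2) / r)"
    proof -
      have "- (1 / (r * q)) - - (r / q) = - ((1 - r * r) / (r * q))"
        using q assms by (simp add: field_simps)
      also have "\<dots> = - (q / r)"
        unfolding q(2)[symmetric] using q(1) by simp
      finally show ?thesis
        by (simp add: q_def)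
    qed
  qed
  then show ?thesis
  proof (rule has_field_derivative_transform_within_open[of _ _ _ "{0<..<1}"])
    fix x :: real assume "x \<in> {0<..<1}"
    then show "arcosh (1 / x) - sqrt (1 - x\<^sup>2) = dA x"
      using dA_eq[of x] by simp
  qed (use assms in auto)
qed

text \<open>With a = arcosh(1/r) the claim is a - tanh a \<ge> 0, and a - tanh a has derivative
  tanh^2.\<close>

lemma dA_nonneg:
  assumes "0 < r" "r \<le> 1"
  shows "0 \<le> dA r"
proof -
  have "0 - tanh 0 \<le> a - tanh a" if "0 \<le> a" for a :: real
  proof (rule DERIV_nonneg_imp_nondecreasing[OF that])
    fix x :: real
    have "((\<lambda>a. a - tanh a) has_field_derivative (tanh x)\<^sup>2) (at x)"
      by (auto intro!: derivative_eq_intros)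
    then show "\<exists>D. ((\<lambda>a. a - tanh a) has_field_derivative D) (at x) \<and> 0 \<le> D"
      using zero_le_power2 by blast
  qed
  from this[of "arcosh (1 / r)"] show ?thesis
    using assms by (simp add: dA_def)
qed

text \<open>With 1/r = cosh a, the difference ln(cosh a) - a + tanh a vanishes at 0 and has
  derivative tanh a (1 - tanh a). It serves to bound \<open>dA\<close> near r = 1.\<close>

lemma dA_le_ln:
  assumes "0 < r" "r \<le> 1"
  shows "dA r \<le> ln (1 / r)"
proof -
  have "ln (cosh 0) - 0 + tanh 0 \<le> ln (cosh a) - a + tanh a" if "0 \<le> a" for a :: real
  proof (rule DERIV_nonneg_imp_nondecreasing[OF that])
    fix x :: real assume "0 \<le> x"
    then have "0 \<le> tanh x * (1 - tanh x)"
      using tanh_real_lt_1[of x] by simp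
    moreover have "((\<lambda>a. ln (cosh a) - a + tanh a) has_field_derivative tanh x * (1 - tanh x)) (at x)"
      by (auto intro!: derivative_eq_intros simp: cosh_real_pos tanh_def field_simps power2_eq_square)
    ultimately show "\<exists>D. ((\<lambda>a. ln (cosh a) - a + tanh a) has_field_derivative D) (at x) \<and> 0 \<le> D"
      by blast
  qed
  from this[of "arcosh (1 / r)"] show ?thesis
    using assms by (simp add: dA_def)
qed

text \<open>Allows the arcosh error of the growth estimate to be absorbed into a multiple of dA r +
  1.\<close>

lemma arcosh_le_dA: "arcosh (1 / r) \<le> dA r + 1"
  using tanh_real_lt_1[of "arcosh (1 / r)"] by (simp add: dA_def)

section \<open>Growth of the Bessel function below the turning point\<close>

text \<open>The function F is increasing: with s = sqrt(1 - t^2), t F'(t) = D J / J - l s + K / s,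
  and D J / J is at least sqrt(k^2 - (l t)^2). The arcosh term pays for k being smaller than l; its
  derivative -1/(t s) supplies the K / s.\<close>

lemma bessel_growth:
  fixes k :: nat and l :: real
  defines "K \<equiv> (l\<^sup>2 - (real k)\<^sup>2) / l"
  assumes k: "k > 0" "real k \<le> l" and r: "0 < r" "r \<le> R" "R < 1" "l * R \<le> real k"
  shows "bessel k (l * r) \<le> bessel k (l * R) *
    exp (l * (dA R - dA r) + K * (arcosh (1 / r) - arcosh (1 / R)))"
proof -
  have l: "l > 0"
    using k by (intro less_le_trans[of 0 "real k" l]) auto
  have pos: "bessel k (l * t) > 0" "l * t \<le> real k" if "r \<le> t" "t \<le> R" for t
  proof -
    have "l * t \<le> l * R"
      using that l by (intro mult_left_mono) auto
    then show "l * t \<le> real k"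
      using r by linarith
    then show "bessel k (l * t) > 0"
      using that l r by (intro bessel_pos k) auto
  qed
  define F where "F t = ln (bessel k (l * t)) + l * dA t - K * arcosh (1 / t)" for t
  have "F r \<le> F R"
  proof (rule DERIV_nonneg_imp_nondecreasing[OF r(2)])
    fix t assume t: "r \<le> t" "t \<le> R"
    have t01: "0 < t" "t < 1"
      using t r by auto
    define b where "b = bessel k (l * t)"
    define d where "d = bessel_log_deriv k (l * t)"
    define s where "s = sqrt (1 - t\<^sup>2)"
    have b: "b > 0"
      using pos[OF t] by (simp add: b_def)
    have s: "s > 0" "s\<^sup>2 = 1 - t\<^sup>2"
      using t01 by (auto simp: s_def power_less_one_iff intro: power_le_one)
    have "(F has_field_derivative (d / b - l * s + K / s) / t) (at t)"
      unfolding F_def using b l t01 s(1)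
      by (auto intro!: derivative_eq_intros dA_DERIV arcosh_inverse_DERIV
          simp: b_def[symmetric] d_def[symmetric] s_def[symmetric] field_simps)
    moreover have "0 \<le> (d / b - l * s + K / s) / t"
    proof -
      have lt: "(l * t)\<^sup>2 \<le> (real k)\<^sup>2"
        using pos[OF t] l t01 by (intro power_mono) auto
      have "sqrt ((real k)\<^sup>2 - (l * t)\<^sup>2) \<le> d / b"
        using bessel_log_deriv_ge[of k "l * t"] k l t01 pos[OF t] b
        by (simp add: b_def d_def field_simps)
      \<comment> \<open>With A = l s and \<delta> = l^2 - k^2 the claim is A - \<delta>/A \<le>
        sqrt(A^2 - \<delta>). It follows by squaring, since 0 \<le> \<delta> \<le> A^2.\<close>
      moreover have "l * s - K / s \<le> sqrt ((real k)\<^sup>2 - (l * t)\<^sup>2)"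
      proof (rule real_le_rsqrt)
        define A where "A = l * s"
        define \<delta> where "\<delta> = l\<^sup>2 - (real k)\<^sup>2"
        have A: "A > 0" "A\<^sup>2 = l\<^sup>2 - (l * t)\<^sup>2"
          using l s(1) by (auto simp: A_def power_mult_distrib s(2) right_diff_distrib)
        have \<delta>: "0 \<le> \<delta>" "\<delta> \<le> A\<^sup>2"
          using k lt by (auto simp: \<delta>_def A(2) intro!: power_mono)
        have "(A - \<delta> / A)\<^sup>2 = A\<^sup>2 - 2 * \<delta> + \<delta> * (\<delta> / A\<^sup>2)"
          using A by (simp add: power2_eq_square field_simps)
        also have "\<delta> * (\<delta> / A\<^sup>2) \<le> \<delta> * 1"
          using \<delta> A(1) by (intro mult_left_mono) (auto simp: divide_le_eq_1)
        finally have "(A - \<delta> / A)\<^sup>2 \<le> A\<^sup>2 - \<delta>"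
          by simp
        then show "(l * s - K / s)\<^sup>2 \<le> (real k)\<^sup>2 - (l * t)\<^sup>2"
          using A by (simp add: K_def A_def \<delta>_def)
      qed
      ultimately show ?thesis
        using t01 by simp
    qed
    ultimately show "\<exists>D. (F has_field_derivative D) (at t) \<and> 0 \<le> D"
      by blast
  qed
  then have "ln (bessel k (l * r)) \<le> ln (bessel k (l * R)) +
      (l * (dA R - dA r) + K * (arcosh (1 / r) - arcosh (1 / R)))"
    by (simp add: F_def algebra_simps)
  then have "exp (ln (bessel k (l * r))) \<le> exp (ln (bessel k (l * R)) +
      (l * (dA R - dA r) + K * (arcosh (1 / r) - arcosh (1 / R))))"
    by simp
  then show ?thesis
    using pos[of r] pos[of R] r by (simp add: exp_add)
qed

text \<open>The square of the Sturm bound exceeds k^2 by terms of order \<omega>^2 and k^2/\<omega>.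
  The choice \<omega> = k^(2/3) balances them at k^(4/3) and gives k^2 = \<omega>^3, so that the
  estimate is polynomial in \<omega>.\<close>

lemma bessel_zero_near:
  "\<exists>M\<ge>1. \<forall>k>0. \<exists>x. real k < x \<and> x\<^sup>2 \<le> (real k)\<^sup>2 + M * real k powr (4/3) \<and> bessel k x = 0"
proof -
  \<comment> \<open>Comes from exp p \<le> 1 + p exp p with p = 2 pi/\<omega> \<le> 2 pi.\<close>
  define A where "A = 2 * pi * exp (2 * pi)"
  have A: "A > 0"
    by (simp add: A_def)
  have "\<exists>x. real k < x \<and> x\<^sup>2 \<le> (real k)\<^sup>2 + (1 + 2 * A) * real k powr (4/3) \<and> bessel k x = 0" if k: "k > 0" for k
  proof -
    define \<omega> where "\<omega> = real k powr (2/3)"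
    have w2: "\<omega>\<^sup>2 = real k powr (4/3)"
      using k by (simp add: \<omega>_def powr_powr flip: powr_numeral)
    have w3: "\<omega> ^ 3 = (real k)\<^sup>2"
      using k by (simp add: \<omega>_def powr_powr flip: powr_numeral)
    have w: "\<omega> \<ge> 1"
      using k by (simp add: \<omega>_def ge_one_powr_ge_zero)
    then obtain x where x: "real k < x" "x \<le> sqrt ((real k)\<^sup>2 + \<omega>\<^sup>2) * exp (pi / \<omega>)" "bessel k x = 0"
      using bessel_zero_exists[OF k, of \<omega>] by auto
    define p where "p = 2 * pi / \<omega>"
    have p: "0 \<le> p" "p \<le> 2 * pi"
      using w by (auto simp: p_def field_simps)
    have "exp p * (1 - p) \<le> exp p * exp (- p)"
      using exp_ge_add_one_self[of "- p"] by (intro mult_left_mono) auto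
    then have "exp p \<le> 1 + p * exp p"
      by (simp add: exp_minus field_simps)
    also have "\<dots> \<le> 1 + p * exp (2 * pi)"
      using p by (intro add_left_mono mult_left_mono) auto
    finally have ep: "exp p \<le> 1 + A / \<omega>"
      by (simp add: A_def p_def)
    have "x\<^sup>2 \<le> (sqrt ((real k)\<^sup>2 + \<omega>\<^sup>2) * exp (pi / \<omega>))\<^sup>2"
      using x k by (intro power_mono) auto
    also have "\<dots> = ((real k)\<^sup>2 + \<omega>\<^sup>2) * exp p"
      by (simp add: power_mult_distrib p_def flip: exp_double)
    also have "\<dots> \<le> (\<omega> ^ 3 + \<omega>\<^sup>2) * (1 + A / \<omega>)"
      unfolding w3[symmetric] using ep w by (intro mult_left_mono) auto
    also have "\<dots> = \<omega> ^ 3 + \<omega>\<^sup>2 + A * \<omega>\<^sup>2 + A * \<omega>"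
      using w by (simp add: field_simps power2_eq_square power3_eq_cube)
    also have "\<dots> \<le> \<omega> ^ 3 + (1 + 2 * A) * \<omega>\<^sup>2"
    proof -
      have "\<omega> \<le> \<omega>\<^sup>2"
        using w by (simp add: power2_eq_square)
      then have "A * \<omega> \<le> A * \<omega>\<^sup>2"
        using A by simp
      then show ?thesis
        by (simp add: algebra_simps)
    qed
    finally show ?thesis
      using x w2 w3 by auto
  qed
  then show ?thesis
    using A by (intro exI[of _ "1 + 2 * A"]) auto
qed

section \<open>Lower bound for the L2 norm of a mode\<close>

text \<open>In a sector of aperture about 1/(3k) the angular factor cos(k \<theta>) stays away from
  0. The unit vector u = z/|z| satisfies |u - 1| \<le> 2/(3k), hence |u^k - 1| \<le> 2/3 and Re(u^k)
  \<ge> 1/3.\<close>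

lemma Re_power_ge:
  assumes "k > 0" "x > 0" "3 * real k * \<bar>y\<bar> \<le> x"
  shows "cmod (Complex x y) ^ k / 4 \<le> Re (Complex x y ^ k)"
proof -
  define z where "z = Complex x y"
  define \<rho> where "\<rho> = cmod z"
  have \<rho>: "x \<le> \<rho>" "\<rho> > 0"
    using assms(2) complex_Re_le_cmod[of z] by (auto simp: \<rho>_def z_def)
  define u where "u = z / of_real \<rho>"
  have u: "cmod u = 1"
    using \<rho> by (simp add: u_def norm_divide) (simp add: \<rho>_def)
  have "cmod (z - of_real \<rho>) \<le> cmod (z - of_real x) + cmod (of_real x - of_real \<rho>)"
    by norm
  also have "cmod (of_real x - of_real \<rho>) = \<rho> - x"
    using \<rho> unfolding of_real_diff[symmetric] norm_of_real by simp
  also have "z - of_real x = \<i> * of_real y"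
    by (simp add: z_def complex_eq_iff)
  also have "\<rho> \<le> x + \<bar>y\<bar>"
    using cmod_le[of z] assms by (simp add: \<rho>_def z_def)
  finally have d: "cmod (z - of_real \<rho>) \<le> 2 * \<bar>y\<bar>"
    by (simp add: norm_mult)
  have "cmod (u - 1) = cmod (z - of_real \<rho>) / \<rho>"
  proof -
    have "u - 1 = (z - of_real \<rho>) / of_real \<rho>"
      using \<rho> by (simp add: u_def diff_divide_distrib)
    then show ?thesis
      using \<rho> by (simp add: norm_divide)
  qed
  also have "\<dots> \<le> 2 * \<bar>y\<bar> / x"
    using d \<rho> assms by (intro frac_le) auto
  finally have "real k * cmod (u - 1) \<le> real k * (2 * \<bar>y\<bar> / x)"
    by (intro mult_left_mono) auto
  also have "\<dots> \<le> 2 / 3"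
    using assms by (simp add: field_simps)
  finally have "cmod (u ^ k - 1) \<le> 2 / 3"
    using norm_power_diff[of u 1 k] u by simp
  then have "Re (u ^ k) \<ge> 1 / 4"
    using complex_Re_le_cmod[of "1 - u ^ k"] by (simp add: norm_minus_commute)
  then have "\<rho> ^ k * (1 / 4) \<le> \<rho> ^ k * Re (u ^ k)"
    using \<rho> by (intro mult_left_mono) auto
  also have "\<rho> ^ k * Re (u ^ k) = Re (of_real (\<rho> ^ k) * u ^ k)"
    by simp
  also have "of_real (\<rho> ^ k) * u ^ k = z ^ k"
    using \<rho> by (simp add: u_def power_divide)
  finally show ?thesis
    by (simp add: z_def \<rho>_def)
qed

lemma bessel_norm_eq:
  "bessel k (l * norm x) = l ^ k * (norm x ^ k * bessel_series k (l\<^sup>2 * (x \<bullet> x)))"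
  by (simp add: bessel_def power_mult_distrib dot_square_norm)

lemma abs_disk_mode_le: "l ^ k * \<bar>disk_mode k (l\<^sup>2) x\<bar> \<le> \<bar>bessel k (l * norm x)\<bar>" if "l \<ge> 0"
proof -
  have "\<bar>Re (plane_complex x ^ k)\<bar> \<le> norm x ^ k"
    using abs_Re_le_cmod[of "plane_complex x ^ k"] by (simp add: norm_power norm_plane_complex)
  then have "l ^ k * (\<bar>Re (plane_complex x ^ k)\<bar> * \<bar>bessel_series k (l\<^sup>2 * (x \<bullet> x))\<bar>) \<le>
      l ^ k * (norm x ^ k * \<bar>bessel_series k (l\<^sup>2 * (x \<bullet> x))\<bar>)"
    using that by (intro mult_left_mono mult_right_mono) auto
  then show ?thesis
    using that by (simp add: bessel_norm_eq disk_mode_def abs_mult)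
qed

lemma continuous_on_disk_mode: "continuous_on S (disk_mode k \<mu>)"
proof -
  have "Ck_on 0 (disk_mode k \<mu>) UNIV"
    using smooth_on_bessel_algebra[OF disk_mode_in_bessel_algebra] unfolding smooth_on_def by blast
  then show ?thesis
    by (auto intro: continuous_on_subset)
qed

text \<open>The integral is restricted to the square [R, R + h] x [0, h] of area h^2. There R \<le>
  |x| \<le> R + 2h, so J(l |x|) \<ge> J(l R) by monotonicity before the turning point, and the
  square is thin enough for the angular factor to be at least 1/4.\<close>

lemma disk_mode_norm_ge:
  assumes k: "k > 0" and l: "l > 0" and R: "0 < R" and h: "0 \<le> h" "h \<le> R / (3 * real k)"
    and le: "l * (R + 2 * h) \<le> real k" "R + 2 * h \<le> 1"
  shows "(h * bessel k (l * R) / (4 * l ^ k))\<^sup>2 \<le> integral (cball 0 1) (\<lambda>x. (disk_mode k (l\<^sup>2) x)\<^sup>2)"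
proof -
  define a :: "real^2" where "a = vector [R, 0]"
  define b :: "real^2" where "b = vector [R + h, h]"
  define c where "c = (bessel k (l * R) / (4 * l ^ k))\<^sup>2"
  have box: "x \<in> cbox a b \<longleftrightarrow> R \<le> x $ 1 \<and> x $ 1 \<le> R + h \<and> 0 \<le> x $ 2 \<and> x $ 2 \<le> h" for x
    by (auto simp: mem_box_cart forall_2 a_def b_def)
  have norm_box: "R \<le> norm x" "norm x \<le> R + 2 * h" if "x \<in> cbox a b" for x
    using that component_le_norm_cart[of x 1] norm_le_l1_cart[of x] R h
    by (auto simp: box sum_2)
  have sub: "cbox a b \<subseteq> cball 0 1"
    using norm_box(2) le by force
  have point: "c \<le> (disk_mode k (l\<^sup>2) x)\<^sup>2" if x: "x \<in> cbox a b" for x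
  proof -
    have "3 * real k * \<bar>x $ 2\<bar> \<le> 3 * real k * h"
      using x by (intro mult_left_mono) (auto simp: box)
    also have "\<dots> \<le> R"
      using h k by (simp add: field_simps)
    finally have Re: "norm x ^ k / 4 \<le> Re (plane_complex x ^ k)"
      using Re_power_ge[of k "x $ 1" "x $ 2"] k R x norm_plane_complex[of x]
      by (auto simp: box plane_complex_def)
    have lx: "l * norm x \<le> l * (R + 2 * h)" "l * R \<le> l * norm x"
      using norm_box[OF x] l by auto
    then have lxk: "l * norm x \<le> real k"
      using le by linarith
    have "bessel k (l * R) \<le> bessel k (l * norm x)"
      using lx lxk k l R by (intro bessel_mono) auto
    then have "bessel k (l * R) / (4 * l ^ k) \<le> bessel k (l * norm x) / (4 * l ^ k)"
      using l by (intro divide_right_mono) auto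
    also have "\<dots> = norm x ^ k / 4 * bessel_series k (l\<^sup>2 * (x \<bullet> x))"
      using l by (simp add: bessel_norm_eq)
    also have "\<dots> \<le> disk_mode k (l\<^sup>2) x"
    proof -
      have "0 < bessel k (l * norm x)"
        using lxk k l R norm_box(1)[OF x] by (intro bessel_pos mult_pos_pos) linarith+
      then have "0 \<le> bessel_series k (l\<^sup>2 * (x \<bullet> x))"
        using l norm_box(1)[OF x] R by (auto simp: bessel_norm_eq zero_less_mult_iff)
      then show ?thesis
        using Re unfolding disk_mode_def by (rule mult_right_mono[rotated])
    qed
    finally show ?thesis
      unfolding c_def using bessel_pos[of k "l * R"] order_trans[OF lx(2) lxk] l R k
      by (intro power_mono) auto
  qed
  have cont: "continuous_on S (\<lambda>x. (disk_mode k (l\<^sup>2) x)\<^sup>2)" for S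
    by (intro continuous_intros continuous_on_disk_mode)
  have "measure lborel (cbox a b) = h * h"
  proof -
    have "a \<in> cbox a b"
      using h by (simp add: box) (simp add: a_def)
    then show ?thesis
      by (auto simp: content_cbox_if_cart prod_2 a_def b_def UNIV_2)
  qed
  then have "(h * bessel k (l * R) / (4 * l ^ k))\<^sup>2 = integral (cbox a b) (\<lambda>_. c)"
    by (simp add: c_def power_mult_distrib power_divide power2_eq_square)
  also have "\<dots> \<le> integral (cbox a b) (\<lambda>x. (disk_mode k (l\<^sup>2) x)\<^sup>2)"
    using point by (intro integral_le integrable_continuous cont) auto
  also have "\<dots> \<le> integral (cball 0 1) (\<lambda>x. (disk_mode k (l\<^sup>2) x)\<^sup>2)"
  proof (rule integral_subset_le[OF sub])
    show "(\<lambda>x. (disk_mode k (l\<^sup>2) x)\<^sup>2) integrable_on cball 0 1"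
      using borel_integrable_compact[OF compact_cball cont]
      by (intro set_borel_integral_eq_integral(1)) (simp add: set_integrable_def)
  qed (auto intro!: integrable_continuous cont)
  finally show ?thesis .
qed

definition disk_mode_norm :: "nat \<Rightarrow> real \<Rightarrow> real" where
  "disk_mode_norm k \<mu> = sqrt (integral (cball 0 1) (\<lambda>x. (disk_mode k \<mu> x)\<^sup>2))"

lemma disk_mode_norm_pos:
  assumes "k > 0" "real k \<le> l"
  shows "disk_mode_norm k (l\<^sup>2) > 0"
proof -
  have l: "l > 0"
    using assms by (intro less_le_trans[of 0 "real k" l]) auto
  \<comment> \<open>A crude square suffices for positivity: R is half the turning radius, h is the
    largest width the sector allows, and 2h \<le> R keeps the square before the turning
    point.\<close>
  define R where "R = real k / (2 * l)"
  define h where "h = R / (3 * real k)"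
  have R: "R > 0" "2 * R \<le> 1" "l * (2 * R) = real k"
    using assms l by (auto simp: R_def field_simps)
  have h: "h > 0" "2 * h \<le> R"
  proof -
    have "2 * R \<le> 3 * (real k * R)"
      using assms R by (simp add: mult_le_cancel_right)
    then show "2 * h \<le> R"
      using assms by (simp add: h_def field_simps)
  qed (use assms R in \<open>simp add: h_def\<close>)
  have "l * (R + 2 * h) \<le> l * (2 * R)"
    using h l by (intro mult_left_mono) auto
  then have "(h * bessel k (l * R) / (4 * l ^ k))\<^sup>2 \<le> integral (cball 0 1) (\<lambda>x. (disk_mode k (l\<^sup>2) x)\<^sup>2)"
    using assms l R h by (intro disk_mode_norm_ge) (auto simp: h_def)
  moreover have "bessel k (l * R) > 0"
    using assms l R by (intro bessel_pos) auto
  then have "(h * bessel k (l * R) / (4 * l ^ k))\<^sup>2 > 0"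
    using h l by simp
  ultimately have "0 < integral (cball 0 1) (\<lambda>x. (disk_mode k (l\<^sup>2) x)\<^sup>2)"
    by linarith
  then show ?thesis
    by (simp add: disk_mode_norm_def)
qed

section \<open>Exponential bound for the normalised mode\<close>

text \<open>The parameter y is \<lambda>^(1/6), so sqrt(\<lambda>) = y^3 and \<lambda>^(-1/3) =
  1/y^2. Dividing by the norm bound on a square at R leaves (4/h) J(l r) / J(l R), to which the
  growth estimate applies. The constant C collects 27 from 4/h, M from the arcosh error and 2 (M +
  1) from l dA(R).\<close>

lemma disk_mode_exp_bound:
  fixes M y :: real
  defines "l \<equiv> y ^ 3" and "C \<equiv> 3 * M + 29"
  assumes k: "k > 0" "real k \<le> l" and M: "M \<ge> 0" and y: "y \<ge> 1"
    and near: "y ^ 6 - M * y ^ 4 \<le> (real k)\<^sup>2" and large: "2 * (M + 1) \<le> y\<^sup>2"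
    and r: "0 < r" "r \<le> 1 - (M + 1) / y\<^sup>2" and x: "norm x < r"
  shows "\<bar>disk_mode k (l\<^sup>2) x / disk_mode_norm k (l\<^sup>2)\<bar> \<le> exp (- (l - C * y) * dA r + C * y)"
proof -
  \<comment> \<open>R is the endpoint of the range of r. The part M/y^2 keeps l R below the turning
    point, and the additional 1/y^2 makes room for the square of width h behind R.\<close>
  define R where "R = 1 - (M + 1) / y\<^sup>2"
  \<comment> \<open>This is (1/2) / (3 l), admissible for the sector because R \<ge> 1/2 and k \<le>
    l.\<close>
  define h where "h = 1 / (6 * y ^ 3)"
  define K where "K = (l\<^sup>2 - (real k)\<^sup>2) / l"
  define b where "b = bessel k (l * R)"
  have l: "l > 0"
    using y by (simp add: l_def)
  have R: "1 / 2 \<le> R" "R < 1" "r \<le> R"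
    using large M y r by (auto simp: R_def field_simps)
  have h: "h > 0"
    using y by (simp add: h_def)
  have Rh: "R + 2 * h \<le> 1 - M / y\<^sup>2"
  proof -
    have "2 * h = 1 / (3 * y) * (1 / y\<^sup>2)"
      by (simp add: h_def power2_eq_square power3_eq_cube)
    also have "\<dots> \<le> 1 * (1 / y\<^sup>2)"
      using y by (intro mult_right_mono) auto
    finally show ?thesis
      by (simp add: R_def add_divide_distrib)
  qed
  have My: "0 \<le> M / y\<^sup>2" "M / y\<^sup>2 \<le> 1"
    using M large y by (auto simp: field_simps)
  have lRh: "l * (R + 2 * h) \<le> real k"
  proof (rule power2_le_imp_le)
    have "(l * (R + 2 * h))\<^sup>2 \<le> (l * (1 - M / y\<^sup>2))\<^sup>2"
      using l Rh R h by (intro power_mono mult_left_mono) auto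
    also have "\<dots> = l\<^sup>2 * ((1 - M / y\<^sup>2) * (1 - M / y\<^sup>2))"
      by (simp add: power2_eq_square algebra_simps)
    also have "\<dots> \<le> l\<^sup>2 * ((1 - M / y\<^sup>2) * 1)"
      using My by (intro mult_left_mono) auto
    also have "\<dots> = y ^ 6 - M * y ^ 4"
      using y by (simp add: l_def field_simps flip: power_mult power_add)
    finally show "(l * (R + 2 * h))\<^sup>2 \<le> (real k)\<^sup>2"
      using near by linarith
  qed simp
  have "l * R \<le> l * (R + 2 * h)"
    using h l by (intro mult_left_mono) auto
  then have lR: "l * R \<le> real k"
    using lRh by linarith
  have b: "b > 0"
    unfolding b_def using k l R lR by (intro bessel_pos) auto
  have "h * b / (4 * l ^ k) \<le> disk_mode_norm k (l\<^sup>2)"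
  proof -
    have "h \<le> R / (3 * real k)"
    proof -
      have "h = (1 / 2) / (3 * l)"
        by (simp add: h_def l_def)
      also have "\<dots> \<le> R / (3 * real k)"
        using R k l by (intro frac_le) auto
      finally show ?thesis .
    qed
    then have "(h * b / (4 * l ^ k))\<^sup>2 \<le> integral (cball 0 1) (\<lambda>x. (disk_mode k (l\<^sup>2) x)\<^sup>2)"
      unfolding b_def using h lRh R k l Rh My by (intro disk_mode_norm_ge) auto
    then show ?thesis
      unfolding disk_mode_norm_def by (rule real_le_rsqrt)
  qed
  then have "\<bar>disk_mode k (l\<^sup>2) x / disk_mode_norm k (l\<^sup>2)\<bar> \<le> \<bar>disk_mode k (l\<^sup>2) x\<bar> / (h * b / (4 * l ^ k))"
    using h b l unfolding abs_divide by (intro frac_le) auto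
  also have "\<dots> = 4 / h * (l ^ k * \<bar>disk_mode k (l\<^sup>2) x\<bar> / b)"
    by (simp add: field_simps)
  also have "\<dots> \<le> 4 / h * (bessel k (l * r) / b)"
  proof -
    have le: "0 \<le> l * norm x" "l * norm x \<le> l * r" "l * r \<le> l * R"
      using x l R by auto
    have "bessel k (l * norm x) \<le> bessel k (l * r)" "bessel k 0 \<le> bessel k (l * norm x)"
      using le k lR by (intro bessel_mono; linarith)+
    moreover have "bessel k 0 = 0"
      using k by (simp add: bessel_def zero_power)
    ultimately have "bessel k (l * norm x) \<le> bessel k (l * r)" "0 \<le> bessel k (l * norm x)"
      by simp_all
    then show ?thesis
      using abs_disk_mode_le[of l k x] l h b by (intro mult_left_mono divide_right_mono) auto
  qed
  also have "\<dots> \<le> 4 / h * (b * exp (l * (dA R - dA r) + K * (arcosh (1 / r) - arcosh (1 / R))) / b)"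
    unfolding b_def K_def using h b k r R lR
    by (intro mult_left_mono divide_right_mono bessel_growth) (auto simp: b_def)
  also have "\<dots> = (4 / h) * exp (l * (dA R - dA r) + K * (arcosh (1 / r) - arcosh (1 / R)))"
    using b by simp
  \<comment> \<open>The polynomial loss 4/h = 24 y^3 is absorbed by 24 \<le> exp(24 y) and y^3 \<le>
    exp(3 y).\<close>
  also have "\<dots> \<le> exp (27 * y) * exp (- (l - C * y) * dA r + (3 * M + 2) * y)"
  proof (rule mult_mono)
    have "y \<le> exp y"
      using exp_ge_add_one_self[of y] by linarith
    then have "y ^ 3 \<le> exp y ^ 3"
      using y by (intro power_mono) auto
    moreover have "24 \<le> exp (24 * y)"
      using exp_ge_add_one_self[of "24 * y"] y by linarith
    ultimately have "24 * y ^ 3 \<le> exp (24 * y) * exp y ^ 3"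
      using y by (intro mult_mono) auto
    also have "\<dots> = exp (27 * y)"
      by (simp flip: exp_of_nat_mult exp_add)
    finally show "4 / h \<le> exp (27 * y)"
      by (simp add: h_def)
  next
    have dr: "0 \<le> dA r"
      using r R by (intro dA_nonneg) auto
    have "K = (y ^ 6 - (real k)\<^sup>2) / y ^ 3"
      by (simp add: K_def l_def flip: power_mult)
    also have "\<dots> \<le> (M * y ^ 4) / y ^ 3"
      using near y by (intro divide_right_mono) auto
    also have "\<dots> = M * y"
      using y by (simp add: field_simps flip: power_Suc)
    finally have K: "K \<le> M * y" .
    have "0 \<le> K"
      using k l by (auto simp: K_def intro!: divide_nonneg_pos power_mono)
    moreover have "arcosh (1 / r) - arcosh (1 / R) \<le> dA r + 1"
    proof -
      have "0 \<le> arcosh (1 / R)"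
        using R by (intro arcosh_nonneg_real) (simp add: field_simps)
      then show ?thesis
        using arcosh_le_dA[of r] by linarith
    qed
    ultimately have "K * (arcosh (1 / r) - arcosh (1 / R)) \<le> K * (dA r + 1)"
      by (intro mult_left_mono)
    also have "\<dots> \<le> M * y * (dA r + 1)"
      using K dr by (intro mult_right_mono) auto
    finally have 1: "K * (arcosh (1 / r) - arcosh (1 / R)) \<le> M * y * (dA r + 1)" .
    \<comment> \<open>Since 1 - R = (M + 1)/y^2, dA(R) is O(y^(-2)), and l = y^3 turns this into
      O(y).\<close>
    have "dA R \<le> ln (1 / R)"
      using R by (intro dA_le_ln) auto
    also have "\<dots> \<le> 1 / R - 1"
      using R by (intro ln_le_minus_one) auto
    also have "\<dots> = (1 - R) / R"
      using R by (simp add: field_simps)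
    also have "\<dots> \<le> (1 - R) / (1 / 2)"
      using R by (intro divide_left_mono) auto
    also have "\<dots> = 2 * ((M + 1) / y\<^sup>2)"
      by (simp add: R_def)
    finally have "l * dA R \<le> l * (2 * ((M + 1) / y\<^sup>2))"
      using l by (intro mult_left_mono) auto
    also have "\<dots> = 2 * (M + 1) * y"
      using y by (simp add: l_def power2_eq_square power3_eq_cube)
    finally have 2: "l * dA R \<le> 2 * (M + 1) * y" .
    have "M * y * dA r \<le> C * y * dA r"
      using M y dr by (intro mult_right_mono) (auto simp: C_def)
    with 1 2 have "l * (dA R - dA r) + K * (arcosh (1 / r) - arcosh (1 / R))
        \<le> - (l - C * y) * dA r + (3 * M + 2) * y"
      by (simp add: algebra_simps)
    then show "exp (l * (dA R - dA r) + K * (arcosh (1 / r) - arcosh (1 / R)))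
        \<le> exp (- (l - C * y) * dA r + (3 * M + 2) * y)"
      by simp
  qed simp_all
  also have "\<dots> = exp (- (l - C * y) * dA r + C * y)"
    by (simp add: C_def algebra_simps flip: exp_add)
  finally show ?thesis .
qed

section \<open>Choice of eigenvalues and assembly\<close>

text \<open>For functions smooth up to the closed disk, membership in H^1_0 amounts to vanishing on
  the unit circle. The eigenvalue is the square of a zero of J near k, which places that zero at
  radius 1.\<close>

theorem theorem1p12:
  "\<exists>(\<psi> :: nat \<Rightarrow> real^2 \<Rightarrow> real) (lam :: nat \<Rightarrow> real).
     (\<forall>k. smooth_closed_disk (\<psi> k)
          \<and> (\<forall>x. norm x = 1 \<longrightarrow> \<psi> k x = 0)
          \<and> lam k \<ge> 0
          \<and> integral (cball 0 1) (\<lambda>x. (\<psi> k x)\<^sup>2) = 1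
          \<and> (\<forall>x\<in>ball 0 1. - laplacian (\<psi> k) x = lam k * \<psi> k x))
   \<and> (\<lambda>k. lam k - (real k)\<^sup>2) \<in> O(\<lambda>k. real k powr (4/3))
   \<and> (\<exists>C>0. \<exists>\<beta>>0. \<exists>k0>0. \<forall>k\<ge>k0. \<forall>r. 0 < r \<and> r \<le> 1 - \<beta> * lam k powr (-1/3) \<longrightarrow>
        (\<forall>x\<in>ball 0 r. \<bar>\<psi> k x\<bar> \<le>
           exp (- (sqrt (lam k) - C * lam k powr (1/6)) * dA r + C * lam k powr (1/6))))"
proof -
  obtain M where M: "M \<ge> 1" and
    ex: "\<And>k. k > 0 \<Longrightarrow> \<exists>x. real k < x \<and> x\<^sup>2 \<le> (real k)\<^sup>2 + M * real k powr (4/3) \<and> bessel k x = 0"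
    using bessel_zero_near by blast
  then obtain z where z: "\<And>k. k > 0 \<Longrightarrow> real k < z k"
    "\<And>k. k > 0 \<Longrightarrow> (z k)\<^sup>2 \<le> (real k)\<^sup>2 + M * real k powr (4/3)"
    "\<And>k. k > 0 \<Longrightarrow> bessel k (z k) = 0"
    by metis
  \<comment> \<open>The index 0 reuses the mode of order 1, since only large indices are constrained asymptotically.\<close>
  define m :: "nat \<Rightarrow> nat" where "m k = max 1 k" for k
  have m: "m k > 0" for k
    by (simp add: m_def)
  define lam where "lam k = (z (m k))\<^sup>2" for k
  define \<psi> where "\<psi> k x = 1 / disk_mode_norm (m k) (lam k) * disk_mode (m k) (lam k) x" for k x
  have N: "disk_mode_norm (m k) (lam k) > 0" for k
    unfolding lam_def using z(1)[OF m, of k] by (intro disk_mode_norm_pos m) auto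
  have "smooth_closed_disk (\<psi> k)" for k
  proof -
    have "\<psi> k \<in> bessel_algebra (lam k)"
      unfolding \<psi>_def[abs_def]
      by (intro bessel_algebra.mult bessel_algebra.const disk_mode_in_bessel_algebra)
    then have "smooth_on (\<psi> k) UNIV"
      by (rule smooth_on_bessel_algebra)
    then show ?thesis
      unfolding smooth_closed_disk_def by blast
  qed
  moreover have "\<psi> k x = 0" if "norm x = 1" for k x
  proof -
    have "bessel_series (m k) (lam k) = 0"
      using z(1,3)[OF m, of k] by (auto simp: bessel_def lam_def)
    then show ?thesis
      using that by (simp add: \<psi>_def disk_mode_def dot_square_norm)
  qed
  moreover have "integral (cball 0 1) (\<lambda>x. (\<psi> k x)\<^sup>2) = 1" for k
  proof -
    have "integral (cball 0 1) (\<lambda>x. (\<psi> k x)\<^sup>2) =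
        (1 / disk_mode_norm (m k) (lam k))\<^sup>2 * integral (cball 0 1) (\<lambda>x. (disk_mode (m k) (lam k) x)\<^sup>2)"
      unfolding \<psi>_def power_mult_distrib by (rule integral_mult_right)
    also have "integral (cball 0 1) (\<lambda>x. (disk_mode (m k) (lam k) x)\<^sup>2) = (disk_mode_norm (m k) (lam k))\<^sup>2"
      using N[of k] by (simp add: disk_mode_norm_def)
    finally show ?thesis
      using N[of k] by (simp add: power_divide)
  qed
  moreover have "- laplacian (\<psi> k) x = lam k * \<psi> k x" for k x
    unfolding \<psi>_def[abs_def] laplacian_cmult_disk_mode by simp
  moreover have "(\<lambda>k. lam k - (real k)\<^sup>2) \<in> O(\<lambda>k. real k powr (4/3))"
  proof (rule bigoI)
    show "\<forall>\<^sub>F k in sequentially. norm (lam k - (real k)\<^sup>2) \<le> M * norm (real k powr (4/3))"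
      using eventually_gt_at_top[of 0]
    proof eventually_elim
      case (elim k)
      then have "m k = k"
        by (simp add: m_def)
      moreover have "(real k)\<^sup>2 \<le> (z k)\<^sup>2"
        using z(1)[OF elim] by (intro power_mono) auto
      ultimately show ?case
        using z(2)[OF elim] by (simp add: lam_def)
    qed
  qed
  moreover have "\<exists>C>0. \<exists>\<beta>>0. \<exists>k0>0. \<forall>k\<ge>k0. \<forall>r. 0 < r \<and> r \<le> 1 - \<beta> * lam k powr (-1/3) \<longrightarrow>
        (\<forall>x\<in>ball 0 r. \<bar>\<psi> k x\<bar> \<le>
           exp (- (sqrt (lam k) - C * lam k powr (1/6)) * dA r + C * lam k powr (1/6)))"
  proof -
    \<comment> \<open>Chosen so that y^6 = (z k)^2 \<ge> k \<ge> (2 (M + 1))^3, which gives y^2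
      \<ge> 2 (M + 1).\<close>
    define k0 where "k0 = nat \<lceil>(2 * (M + 1)) ^ 3\<rceil>"
    have k0: "(2 * (M + 1)) ^ 3 \<le> real k0"
      unfolding k0_def by (rule real_nat_ceiling_ge)
    have "0 < (2 * (M + 1)) ^ 3"
      using M by simp
    with k0 have "k0 > 0"
      by (metis less_le_trans of_nat_0_less_iff)
    have "\<bar>\<psi> k x\<bar> \<le> exp (- (sqrt (lam k) - (3 * M + 29) * lam k powr (1/6)) * dA r + (3 * M + 29) * lam k powr (1/6))"
      if k: "k \<ge> k0" and r: "0 < r" "r \<le> 1 - (M + 1) * lam k powr (-1/3)" and x: "x \<in> ball 0 r" for k r x
    proof -
      have kpos: "k > 0"
        using k \<open>k0 > 0\<close> by simp
      then have mk: "m k = k"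
        by (simp add: m_def)
      have kz: "real k < z k"
        by (rule z(1)[OF kpos])
      then have zpos: "z k > 1"
        using kpos by linarith
      define y where "y = z k powr (1/3)"
      have y: "y \<ge> 1"
        unfolding y_def using zpos by (intro ge_one_powr_ge_zero) auto
      have y3: "y ^ 3 = z k"
        using zpos by (simp add: y_def powr_powr flip: powr_numeral)
      have y4: "y ^ 4 = z k powr (4/3)"
        using zpos by (simp add: y_def powr_powr flip: powr_numeral)
      have lam: "lam k = (y ^ 3)\<^sup>2"
        by (simp add: lam_def mk y3)
      have lam_powr: "lam k powr a = z k powr (2 * a)" for a
        using zpos by (simp add: lam_def mk powr_powr flip: powr_numeral)
      have lam6: "lam k powr (1/6) = y"
        unfolding lam_powr y_def by simp
      have lam3: "lam k powr (-1/3) = 1 / y\<^sup>2"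
        unfolding lam_powr y_def using zpos
        by (simp add: powr_powr powr_minus_divide flip: powr_numeral)
      have sqrt_lam: "sqrt (lam k) = y ^ 3"
        unfolding lam using y by (intro real_sqrt_unique) auto
      \<comment> \<open>Replacing k by the larger zero in the error term expresses the gap through y
        alone.\<close>
      have "M * real k powr (4/3) \<le> M * z k powr (4/3)"
        using M kz by (intro mult_left_mono powr_mono2) auto
      then have near: "y ^ 6 - M * y ^ 4 \<le> (real k)\<^sup>2"
        using z(2)[OF kpos] y4 y3 power_mult[of y 3 2] by simp
      have large: "2 * (M + 1) \<le> y\<^sup>2"
      proof (rule power_le_imp_le_base)
        have "(2 * (M + 1)) ^ 3 \<le> real k"
          using k0 k by linarith
        also have "\<dots> \<le> z k * z k"
          using kz zpos mult_mono[of 1 "z k" "real k" "z k"] by simp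
        also have "\<dots> = (y\<^sup>2) ^ 3"
          by (simp add: y3[symmetric] flip: power_mult power_add)
        finally show "(2 * (M + 1)) ^ Suc 2 \<le> (y\<^sup>2) ^ Suc 2"
          by simp
      qed simp
      have "\<bar>disk_mode k ((y ^ 3)\<^sup>2) x / disk_mode_norm k ((y ^ 3)\<^sup>2)\<bar>
          \<le> exp (- (y ^ 3 - (3 * M + 29) * y) * dA r + (3 * M + 29) * y)"
        using kpos kz M y near large r[unfolded lam3] x
        by (intro disk_mode_exp_bound) (auto simp: y3)
      then show ?thesis
        unfolding sqrt_lam lam6 by (simp add: \<psi>_def mk lam)
    qed
    then show ?thesis
      using M \<open>k0 > 0\<close>
      by (intro exI[of _ "3 * M + 29"] exI[of _ "M + 1"] exI[of _ k0] conjI) auto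
  qed
  ultimately show ?thesis
    by (intro exI[of _ \<psi>] exI[of _ lam] conjI allI ballI impI) (auto simp: lam_def)
qed

end
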